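(* Fix $\omega\in(0,\infty)$ and define for $\xi_1,\xi_2\in\mathbb R$ $$\nu_{++,\omega}(\xi_1,\xi_2):=\int_{\mathbb R}\bigl(\Psi_{1,\omega}(x,\xi_1)\Psi_{1,\omega}(x,\xi_2)-\Psi_{2,\omega}(x,\xi_1)\Psi_{2,\omega}(x,\xi_2)\bigr)\phi_\omega(x)^2\,dx,$$ $$\nu_{--,\omega}(\xi_1,\xi_2):=\int_{\mathbb R}\bigl(\Psi_{2,\omega}(x,\xi_1)\Psi_{2,\omega}(x,\xi_2)-\Psi_{1,\omega}(x,\xi_1)\Psi_{1,\omega}(x,\xi_2)\bigr)\phi_\omega(x)^2\,dx,$$ $$\nu_{+-,\omega}(\xi_1,\xi_2):=\int_{\mathbb R}\bigl(\Psi_{1,\omega}(x,\xi_1)\Psi_{2,\omega}(x,\xi_2)-\Psi_{2,\omega}(x,\xi_1)\Psi_{1,\omega}(x,\xi_2)\bigr)\phi_\omega(x)^2\,dx.$$ Then $$\nu_{++,\omega}(\xi_1,\xi_2)=(\xi_1^2+\xi_2^2+2\omega)\,\frac{\sqrt\omega}{12}\,\frac{\xi_1^2-4\xi_1\xi_2+\xi_2^2-2\omega}{(|\xi_1|-i\sqrt\omega)^2(|\xi_2|-i\sqrt\omega)^2}\,\frac{\xi_1+\xi_2}{\sqrt\omega}\operatorname{cosech}\Bigl(\frac\pi2\frac{\xi_1+\xi_2}{\sqrt\omega}\Bigr),$$ $$\nu_{+-,\omega}(\xi_1,\xi_2)=(\xi_1^2-\xi_2^2)\,\frac{\sqrt\omega}{12}\,\frac{\xi_1^2+2\xi_1\xi_2+\xi_2^2+4\omega}{(|\xi_1|-i\sqrt\omega)^2(|\xi_2|-i\sqrt\omega)^2}\,\frac{\xi_1+\xi_2}{\sqrt\omega}\operatorname{cosech}\Bigl(\frac\pi2\frac{\xi_1+\xi_2}{\sqrt\omega}\Bigr),$$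 and $\nu_{--,\omega}(\xi_1,\xi_2)=-\nu_{++,\omega}(\xi_1,\xi_2)$.
   Context: For $\omega>0$: $\phi_\omega(x):=\sqrt{2\omega}\operatorname{sech}(\sqrt\omega x)$ and $$\Psi_{1,\omega}(x,\xi):=\frac{1}{\sqrt{2\pi}}\frac{(\xi+i\sqrt\omega\tanh(\sqrt\omega x))^2}{(|\xi|-i\sqrt\omega)^2}e^{ix\xi},\qquad \Psi_{2,\omega}(x,\xi):=\frac{1}{\sqrt{2\pi}}\frac{(\sqrt\omega\operatorname{sech}(\sqrt\omega x))^2}{(|\xi|-i\sqrt\omega)^2}e^{ix\xi}.$$ Here $\operatorname{cosech}=1/\sinh$, and the function $y\mapsto y\operatorname{cosech}(\frac\pi2y)$ is extended continuously to $y=0$ by the value $2/\pi$. *)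

theory Defs
  imports "HOL-Analysis.Analysis"
begin

definition sech :: "real \<Rightarrow> real" where
  "sech x = 1 / cosh x"

definition cosech :: "real \<Rightarrow> real" where
  "cosech x = 1 / sinh x"

text \<open>The function \<open>y * cosech (\<pi> / 2 * y)\<close> has a removable singularity at \<open>y = 0\<close>
  with limit \<open>2 / \<pi>\<close>; the bare formula would give \<open>0\<close> there because \<open>1 / 0 = 0\<close>.\<close>

definition id_cosech :: "real \<Rightarrow> real" where
  "id_cosech y = (if y = 0 then 2 / pi else y * cosech (pi / 2 * y))"

definition \<phi> :: "real \<Rightarrow> real \<Rightarrow> real" where
  "\<phi> \<omega> x = sqrt (2 * \<omega>) * sech (sqrt \<omega> * x)"

definition \<Psi>1 :: "real \<Rightarrow> real \<Rightarrow> real \<Rightarrow> complex" where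
  "\<Psi>1 \<omega> x \<xi> =
     complex_of_real (1 / sqrt (2 * pi)) *
     ((complex_of_real \<xi> + \<i> * complex_of_real (sqrt \<omega> * tanh (sqrt \<omega> * x)))\<^sup>2 /
      (complex_of_real \<bar>\<xi>\<bar> - \<i> * complex_of_real (sqrt \<omega>))\<^sup>2) *
     exp (\<i> * complex_of_real (x * \<xi>))"

definition \<Psi>2 :: "real \<Rightarrow> real \<Rightarrow> real \<Rightarrow> complex" where
  "\<Psi>2 \<omega> x \<xi> =
     complex_of_real (1 / sqrt (2 * pi)) *
     (complex_of_real ((sqrt \<omega> * sech (sqrt \<omega> * x))\<^sup>2) /
      (complex_of_real \<bar>\<xi>\<bar> - \<i> * complex_of_real (sqrt \<omega>))\<^sup>2) *
     exp (\<i> * complex_of_real (x * \<xi>))"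

definition \<nu>_pp_integrand :: "real \<Rightarrow> real \<Rightarrow> real \<Rightarrow> real \<Rightarrow> complex" where
  "\<nu>_pp_integrand \<omega> \<xi>1 \<xi>2 x =
     (\<Psi>1 \<omega> x \<xi>1 * \<Psi>1 \<omega> x \<xi>2 - \<Psi>2 \<omega> x \<xi>1 * \<Psi>2 \<omega> x \<xi>2) * complex_of_real ((\<phi> \<omega> x)\<^sup>2)"

definition \<nu>_mm_integrand :: "real \<Rightarrow> real \<Rightarrow> real \<Rightarrow> real \<Rightarrow> complex" where
  "\<nu>_mm_integrand \<omega> \<xi>1 \<xi>2 x =
     (\<Psi>2 \<omega> x \<xi>1 * \<Psi>2 \<omega> x \<xi>2 - \<Psi>1 \<omega> x \<xi>1 * \<Psi>1 \<omega> x \<xi>2) * complex_of_real ((\<phi> \<omega> x)\<^sup>2)"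

definition \<nu>_pm_integrand :: "real \<Rightarrow> real \<Rightarrow> real \<Rightarrow> real \<Rightarrow> complex" where
  "\<nu>_pm_integrand \<omega> \<xi>1 \<xi>2 x =
     (\<Psi>1 \<omega> x \<xi>1 * \<Psi>2 \<omega> x \<xi>2 - \<Psi>2 \<omega> x \<xi>1 * \<Psi>1 \<omega> x \<xi>2) * complex_of_real ((\<phi> \<omega> x)\<^sup>2)"

definition \<nu>_pp :: "real \<Rightarrow> real \<Rightarrow> real \<Rightarrow> complex" where
  "\<nu>_pp \<omega> \<xi>1 \<xi>2 = (LINT x|lborel. \<nu>_pp_integrand \<omega> \<xi>1 \<xi>2 x)"

definition \<nu>_mm :: "real \<Rightarrow> real \<Rightarrow> real \<Rightarrow> complex" where
  "\<nu>_mm \<omega> \<xi>1 \<xi>2 = (LINT x|lborel. \<nu>_mm_integrand \<omega> \<xi>1 \<xi>2 x)"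

definition \<nu>_pm :: "real \<Rightarrow> real \<Rightarrow> real \<Rightarrow> complex" where
  "\<nu>_pm \<omega> \<xi>1 \<xi>2 = (LINT x|lborel. \<nu>_pm_integrand \<omega> \<xi>1 \<xi>2 x)"

end

theory Submission
  imports Defs "HOL-Complex_Analysis.Complex_Analysis"
begin

text \<open>
  After rescaling \<open>x\<close> by \<open>s = sqrt \<omega>\<close>, each integrand is a cubic polynomial in \<open>tanh y\<close> times
  \<open>sech\<^sup>2 y\<close> times \<open>exp (i k y)\<close> with \<open>k = (\<xi>1 + \<xi>2) / s\<close>; for \<open>\<nu>_pp\<close> the fourth powers of
  \<open>tanh y\<close> cancel because \<open>sech\<^sup>2 = 1 - tanh\<^sup>2\<close>. Integrating the derivative of
  \<open>tanh\<^sup>n y sech\<^sup>2 y exp (i k y)\<close> over the line gives a recurrence that reduces all moments to the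
  Fourier transform of \<open>sech\<^sup>2\<close>. The latter is \<open>\<pi> k / sinh (\<pi> k / 2)\<close>: the function
  \<open>exp (i k z) / cosh\<^sup>2 z\<close> is multiplied by \<open>exp (- \<pi> k)\<close> under \<open>z \<mapsto> z + i \<pi>\<close>, so the residue theorem
  on the strip between \<open>Im z = 0\<close> and \<open>Im z = \<pi>\<close> determines its integral.
\<close>

section \<open>Zeros and modulus of the complex hyperbolic cosine\<close>

text \<open>Read off from the modulus of \<open>cos\<close> at \<open>\<i> * z\<close>. The two
  squares serve two purposes: both must vanish at a zero, and the \<open>sinh\<close> term alone
  bounds the modulus from below on vertical lines.\<close>

lemma norm_cosh_squared:
  "(norm (cosh z))\<^sup>2 = (sinh (Re z))\<^sup>2 + (cos (Im z))\<^sup>2" for z :: complex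
  using norm_cos_squared[of "\<i> * z"]
  by (simp add: cosh_conv_cos sinh_def exp_minus power_divide field_simps)

text \<open>Both squares in the modulus vanish, which gives \<open>Re z = 0\<close> and
  \<open>cos (Im z) = 0\<close>; the open strip ends at the neighbouring zeros, so only
  \<open>pi / 2\<close> remains.\<close>

lemma cosh_eq_0_strip:
  fixes z :: complex
  assumes "cosh z = 0" "- pi / 2 < Im z" "Im z < 3 * pi / 2"
  shows "z = \<i> * complex_of_real (pi / 2)"
proof -
  have "(sinh (Re z))\<^sup>2 + (cos (Im z))\<^sup>2 = 0"
    using norm_cosh_squared[of z] assms(1) by simp
  then have "Re z = 0" "cos (Im z) = 0"
    by (simp_all add: sum_power2_eq_zero_iff)
  moreover have "Im z = pi / 2"
  proof -
    have "sin (Im z - pi / 2) = 0"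
      using \<open>cos (Im z) = 0\<close> by (simp add: sin_diff)
    then show ?thesis
      using sin_eq_0_pi[of "Im z - pi / 2"] assms(2,3) by simp
  qed
  ultimately show ?thesis
    by (simp add: complex_eq_iff)
qed

lemma cosh_i_half_pi: "cosh (\<i> * complex_of_real (pi / 2)) = 0"
proof -
  have "(norm (cosh (\<i> * complex_of_real (pi / 2))))\<^sup>2 = 0"
    by (subst norm_cosh_squared) simp
  then show ?thesis by simp
qed

text \<open>A consequence of \<open>exp (\<i> * pi) = -1\<close>. It makes the square of
  \<open>cosh\<close> periodic, so a shift by \<open>\<i> * pi\<close> affects only the exponential
  factor of the contour integrand.\<close>

lemma cosh_add_i_pi: "cosh (z + \<i> * complex_of_real pi) = - cosh z"
proof -
  have "exp (\<i> * complex_of_real pi) = -1"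
    using exp_pi_i by (simp add: mult.commute)
  then show ?thesis
    by (simp add: cosh_field_def exp_minus exp_add field_simps del: minus_add_distrib)
qed

section \<open>Contour integration over a rectangle\<close>

text \<open>Whatever \<open>R\<close> is, the rectangle encloses just one singularity, the double
  pole at \<open>\<i> * pi / 2\<close>. Its contribution is obtained from the simple pole of
  \<open>exp (\<i> * k * z) * tanh z\<close>, whose residue there is
  \<open>exp (- (pi * k / 2))\<close>.\<close>

lemma contour_integral_rectpath_sech_sq:
  fixes k R :: real
  defines "f \<equiv> \<lambda>z. exp (\<i> * of_real k * z) / (cosh z)\<^sup>2"
  assumes "R > 0"
  shows "contour_integral (rectpath (Complex (- R) 0) (Complex R pi)) f =
    of_real (2 * pi * k * exp (- (pi * k / 2)))"
proof -
  define p where "p = \<i> * complex_of_real (pi / 2)"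
  \<comment> \<open>An open convex set containing the closed rectangle; its edges pass through the
    neighbouring zeros of \<open>cosh\<close>, so \<open>p\<close> is the only zero inside.\<close>
  define S where "S = {z. - pi / 2 < Im z \<and> Im z < 3 * pi / 2}"
  define g where "g = rectpath (Complex (- R) 0) (Complex R pi)"
  \<comment> \<open>\<open>h z / cosh z\<close> is \<open>exp (\<i> * k * z) * tanh z\<close>, kept
    as a quotient to suit the residue formula at a simple zero of the denominator.\<close>
  define h where "h = (\<lambda>z. exp (\<i> * of_real k * z) * sinh z)"
  have S: "open S" "convex S"
  proof -
    have S_eq: "S = {z. - pi / 2 < Im z} \<inter> {z. Im z < 3 * pi / 2}"
      by (auto simp: S_def)
    show "open S" "convex S"
      unfolding S_eq by (intro open_Int convex_Int open_halfspace_Im_gt open_halfspace_Im_lt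
          convex_halfspace_Im_gt convex_halfspace_Im_lt)+
  qed
  have cosh_nz: "cosh z \<noteq> 0" if "z \<in> S - {p}" for z
    using cosh_eq_0_strip[of z] that by (auto simp: S_def p_def)
  have box: "p \<in> box (Complex (- R) 0) (Complex R pi)"
    using \<open>R > 0\<close> by (auto simp: in_box_complex_iff p_def)
  have "path_image g \<subseteq> cbox (Complex (- R) 0) (Complex R pi) - box (Complex (- R) 0) (Complex R pi)"
    using \<open>R > 0\<close> unfolding g_def by (subst path_image_rectpath_cbox_minus_box) auto
  also have "\<dots> \<subseteq> S - {p}"
  proof -
    have "z \<in> S" if "z \<in> cbox (Complex (- R) 0) (Complex R pi)" for z
    proof -
      have "0 \<le> Im z" "Im z \<le> pi"
        using that by (auto simp: in_cbox_complex_iff)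
      then show ?thesis
        unfolding S_def using pi_gt_zero by (intro CollectI conjI; linarith)
    qed
    then show ?thesis
      using box by blast
  qed
  finally have img: "path_image g \<subseteq> S - {p}" .
  have g: "valid_path g" "pathfinish g = pathstart g"
    by (simp_all add: g_def)
  have "residue (\<lambda>z. h z / cosh z) p = h p / sinh p"
  proof (rule residue_simple_pole_deriv)
    show "open S" "connected S" "p \<in> S"
      using S by (auto simp: convex_connected S_def p_def)
    show "cosh holomorphic_on S"
      by (intro analytic_imp_holomorphic analytic_on_cosh analytic_on_ident)
    show "h holomorphic_on S"
      unfolding h_def
      by (intro analytic_imp_holomorphic analytic_intros)
    show "(cosh has_field_derivative sinh p) (at p)"
      by (auto intro!: derivative_eq_intros)
    have "sinh p \<noteq> 0"
      using cosh_square_eq[of p] cosh_i_half_pi by (auto simp: p_def)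
    then show "h p \<noteq> 0" "sinh p \<noteq> 0"
      by (simp_all add: h_def)
    show "cosh p = 0"
      using cosh_i_half_pi by (simp add: p_def)
  qed
  also have "sinh p \<noteq> 0"
    using cosh_square_eq[of p] cosh_i_half_pi by (auto simp: p_def)
  then have "h p / sinh p = exp (\<i> * of_real k * p)"
    by (simp add: h_def)
  also have "\<i> * of_real k * p = of_real (- (pi * k / 2))"
    by (simp add: p_def complex_eq_iff)
  finally have res: "residue (\<lambda>z. h z / cosh z) p = of_real (exp (- (pi * k / 2)))"
    by (simp only: exp_of_real)
  have hol: "(\<lambda>z. h z / cosh z) holomorphic_on S - {p}"
    unfolding h_def using cosh_nz
    by (intro analytic_imp_holomorphic analytic_intros)
  have "contour_integral g (\<lambda>z. h z / cosh z) =
      2 * pi * \<i> * (\<Sum>q\<in>{p}. winding_number g q * residue (\<lambda>z. h z / cosh z) q)"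
  proof (rule Residue_theorem)
    show "\<forall>z. z \<notin> S \<longrightarrow> winding_number g z = 0"
    proof (intro allI impI)
      fix z assume "z \<notin> S"
      then show "winding_number g z = 0"
        using winding_number_zero_outside[of g S z] S g img
        by (auto simp: valid_path_imp_path)
    qed
  qed (use S g img hol in \<open>auto simp: convex_connected\<close>)
  then have int_h: "contour_integral g (\<lambda>z. h z / cosh z) = 2 * pi * \<i> * of_real (exp (- (pi * k / 2)))"
    using winding_number_rectpath[OF box] res by (simp add: g_def)
  have h_int: "(\<lambda>z. h z / cosh z) contour_integrable_on g"
  proof (rule contour_integrable_holomorphic_simple)
    show "open (S - {p})" using S by (simp add: open_delete)
  qed (use g img hol in auto)
  \<comment> \<open>Subtracting the derivative of \<open>h z / cosh z\<close> trades the double pole of \<open>f\<close> for a simple one.\<close>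
  have "((\<lambda>z. f z + \<i> * of_real k * (h z / cosh z)) has_contour_integral 0) g"
  proof (rule Cauchy_theorem_primitive)
    fix z assume "z \<in> S - {p}"
    then have nz: "cosh z \<noteq> 0" by (rule cosh_nz)
    have "((\<lambda>z. h z / cosh z) has_field_derivative
        f z + \<i> * of_real k * (h z / cosh z)) (at z)"
    proof -
      have "((\<lambda>z. h z / cosh z) has_field_derivative
          ((exp (\<i> * of_real k * z) * (\<i> * of_real k) * sinh z + cosh z * exp (\<i> * of_real k * z)) * cosh z
            - h z * sinh z) / (cosh z * cosh z)) (at z)"
        unfolding h_def using nz by (auto intro!: derivative_eq_intros)
      also have "((exp (\<i> * of_real k * z) * (\<i> * of_real k) * sinh z + cosh z * exp (\<i> * of_real k * z)) * cosh z
            - h z * sinh z) = exp (\<i> * of_real k * z) * ((cosh z)\<^sup>2 - (sinh z)\<^sup>2)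
            + \<i> * of_real k * h z * cosh z"
        by (simp add: h_def algebra_simps power2_eq_square)
      also have "(cosh z)\<^sup>2 - (sinh z)\<^sup>2 = 1"
        by (rule hyperbolic_pythagoras)
      also have "(exp (\<i> * of_real k * z) * 1 + \<i> * of_real k * h z * cosh z) / (cosh z * cosh z)
          = f z + \<i> * of_real k * (h z / cosh z)"
        using nz by (simp add: f_def field_simps power2_eq_square)
      finally show ?thesis .
    qed
    then show "((\<lambda>z. h z / cosh z) has_field_derivative
        f z + \<i> * of_real k * (h z / cosh z)) (at z within S - {p})"
      by (rule has_field_derivative_at_within)
  qed (use g img in auto)
  moreover have "((\<lambda>z. \<i> * of_real k * (h z / cosh z)) has_contour_integral
      \<i> * of_real k * (2 * pi * \<i> * of_real (exp (- (pi * k / 2))))) g"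
    using has_contour_integral_integral[OF h_int] unfolding int_h
    by (rule has_contour_integral_lmul)
  ultimately have "((\<lambda>z. (f z + \<i> * of_real k * (h z / cosh z)) - \<i> * of_real k * (h z / cosh z))
      has_contour_integral 0 - \<i> * of_real k * (2 * pi * \<i> * of_real (exp (- (pi * k / 2))))) g"
    by (rule has_contour_integral_diff)
  then have "contour_integral g f = - (\<i> * of_real k * (2 * pi * \<i> * of_real (exp (- (pi * k / 2)))))"
    by (simp add: contour_integral_unique)
  then show ?thesis
    by (simp add: g_def mult_ac)
qed

text \<open>The two horizontal edges differ by the factor \<open>- exp (- (pi * k))\<close> and
  together give the first product; the error consists of the two vertical sides, each of length
  \<open>pi\<close>.\<close>

lemma sech_sq_truncated_fourier:
  fixes k R :: real
  defines "f \<equiv> \<lambda>z. exp (\<i> * of_real k * z) / (cosh z)\<^sup>2"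
  assumes "R > 0"
  shows "norm (of_real (1 - exp (- (pi * k))) * integral {- R..R} (\<lambda>x. f (of_real x))
     - of_real (2 * pi * k * exp (- (pi * k / 2)))) \<le> 2 * (exp (pi * \<bar>k\<bar>) / (sinh R)\<^sup>2 * pi)"
proof -
  define a b c d where "a = Complex (- R) 0" and "b = Complex R 0"
    and "c = Complex R pi" and "d = Complex (- R) pi"
  have f_cont: "continuous_on A f" if "\<And>z. z \<in> A \<Longrightarrow> cosh z \<noteq> 0" for A
    unfolding f_def using that by (auto intro!: continuous_intros)
  have nz_Re: "cosh z \<noteq> 0" if "\<bar>Re z\<bar> = R" for z
  proof
    assume "cosh z = 0"
    then have "sinh (Re z) = 0"
      using norm_cosh_squared[of z] by (simp add: sum_power2_eq_zero_iff)
    then show False using that \<open>R > 0\<close> by simp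
  qed
  have nz_Im: "cosh z \<noteq> 0" if "Im z = 0 \<or> Im z = pi" for z
  proof
    assume "cosh z = 0"
    then have "cos (Im z) = 0"
      using norm_cosh_squared[of z] by (simp add: sum_power2_eq_zero_iff)
    then show False using that by auto
  qed
  have seg: "closed_segment a b \<subseteq> {z. Im z = 0}" "closed_segment c d \<subseteq> {z. Im z = pi}"
    "closed_segment b c \<subseteq> {z. Re z = R \<and> 0 \<le> Im z \<and> Im z \<le> pi}"
    "closed_segment d a \<subseteq> {z. Re z = - R \<and> 0 \<le> Im z \<and> Im z \<le> pi}"
    using \<open>R > 0\<close> by (auto simp: a_def b_def c_def d_def closed_segment_same_Im
        closed_segment_same_Re closed_segment_eq_real_ivl split: if_splits)
  have cont: "continuous_on (closed_segment a b) f" "continuous_on (closed_segment c d) f"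
    using seg(1,2) by (auto intro!: f_cont nz_Im)
  have cont': "continuous_on (closed_segment b c) f" "continuous_on (closed_segment d a) f"
    using seg(3,4) \<open>R > 0\<close> by (auto intro!: f_cont nz_Re)
  note int = cont[THEN contour_integrable_continuous_linepath]
    cont'[THEN contour_integrable_continuous_linepath]
  have "rectpath (Complex (- R) 0) (Complex R pi) =
      linepath a b +++ linepath b c +++ linepath c d +++ linepath d a"
    by (simp add: rectpath_def a_def b_def c_def d_def Let_def)
  then have total: "contour_integral (linepath a b) f + contour_integral (linepath b c) f +
      contour_integral (linepath c d) f + contour_integral (linepath d a) f =
      of_real (2 * pi * k * exp (- (pi * k / 2)))"
    using contour_integral_rectpath_sech_sq[OF \<open>R > 0\<close>, of k] int
    by (simp add: f_def[symmetric] add_ac)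
  have bottom: "contour_integral (linepath a b) f = integral {- R..R} (\<lambda>x. f (of_real x))"
    using contour_integral_linepath_Reals_eq[of a b f] \<open>R > 0\<close>
    by (simp add: a_def b_def complex_is_Real_iff)
  \<comment> \<open>The reversed top edge is the bottom edge translated by
    \<open>\<i> * pi\<close>.\<close>
  have "contour_integral (linepath c d) f = - contour_integral (linepath d c) f"
    using cont(2) by (rule contour_integral_reverse_linepath)
  also have "linepath d c = (+) (\<i> * of_real pi) \<circ> linepath a b"
    by (rule ext) (simp add: linepath_def a_def b_def c_def d_def complex_eq_iff algebra_simps)
  also have "contour_integral \<dots> f = contour_integral (linepath a b) (\<lambda>z. f (z + \<i> * of_real pi))"
    by (rule contour_integral_translate)
  also have "(\<lambda>z. f (z + \<i> * of_real pi)) = (\<lambda>z. of_real (exp (- (pi * k))) * f z)"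
  proof
    fix z
    have "exp (\<i> * of_real k * (z + \<i> * of_real pi)) =
        exp (\<i> * of_real k * z + of_real (- (pi * k)))"
      by (simp add: algebra_simps)
    also have "\<dots> = exp (\<i> * of_real k * z) * of_real (exp (- (pi * k)))"
      by (simp only: exp_add exp_of_real)
    finally show "f (z + \<i> * of_real pi) = of_real (exp (- (pi * k))) * f z"
      by (simp add: f_def cosh_add_i_pi)
  qed
  also have "contour_integral (linepath a b) \<dots> = of_real (exp (- (pi * k))) * contour_integral (linepath a b) f"
    using int(1) by (rule contour_integral_lmul)
  finally have top: "contour_integral (linepath c d) f =
      - (of_real (exp (- (pi * k))) * contour_integral (linepath a b) f)" .
  \<comment> \<open>The numerator has modulus \<open>exp (- (k * Im z))\<close> with
    \<open>Im z\<close> between \<open>0\<close> and \<open>pi\<close>, and the modulus of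
    \<open>cosh z\<close> is at least that of \<open>sinh R\<close>.\<close>
  have bound: "norm (f z) \<le> exp (pi * \<bar>k\<bar>) / (sinh R)\<^sup>2"
    if "\<bar>Re z\<bar> = R" "0 \<le> Im z" "Im z \<le> pi" for z
  proof -
    have "(sinh (Re z))\<^sup>2 = (sinh R)\<^sup>2"
      using that(1) by (auto simp: abs_if split: if_splits)
    then have "(sinh R)\<^sup>2 \<le> (norm (cosh z))\<^sup>2"
      by (simp add: norm_cosh_squared)
    moreover have "norm (exp (\<i> * of_real k * z)) \<le> exp (pi * \<bar>k\<bar>)"
    proof -
      have "- (k * Im z) \<le> \<bar>k\<bar> * Im z"
        using mult_right_mono[OF abs_ge_minus_self[of k] that(2)] by simp
      also have "\<dots> \<le> pi * \<bar>k\<bar>"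
        using that(3) by (simp add: mult.commute mult_right_mono)
      finally show ?thesis by (simp add: mult.commute)
    qed
    ultimately show ?thesis
      using \<open>R > 0\<close> by (auto simp: f_def norm_divide norm_power intro!: frac_le)
  qed
  have len: "norm (c - b) = pi" "norm (a - d) = pi"
    by (simp_all add: a_def b_def c_def d_def cmod_def)
  have "norm (contour_integral (linepath b c) f) \<le> exp (pi * \<bar>k\<bar>) / (sinh R)\<^sup>2 * norm (c - b)"
    using int(3) seg(3) \<open>R > 0\<close> by (intro contour_integral_bound_linepath bound) auto
  moreover have "norm (contour_integral (linepath d a) f) \<le> exp (pi * \<bar>k\<bar>) / (sinh R)\<^sup>2 * norm (a - d)"
    using int(4) seg(4) \<open>R > 0\<close> by (intro contour_integral_bound_linepath bound) auto
  ultimately have "norm (contour_integral (linepath b c) f + contour_integral (linepath d a) f)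
      \<le> 2 * (exp (pi * \<bar>k\<bar>) / (sinh R)\<^sup>2 * pi)"
    unfolding len mult_2 by (intro norm_triangle_le add_mono)
  moreover have "of_real (1 - exp (- (pi * k))) * integral {- R..R} (\<lambda>x. f (of_real x))
     - of_real (2 * pi * k * exp (- (pi * k / 2))) =
     - (contour_integral (linepath b c) f + contour_integral (linepath d a) f)"
    unfolding total[symmetric] top bottom[symmetric] by (simp add: algebra_simps)
  ultimately show ?thesis
    by (simp only: norm_minus_cancel)
qed

section \<open>Real \<open>sech\<close> and \<open>tanh\<close> on the line\<close>

lemma sech_sq_eq: "(sech x)\<^sup>2 = 1 - (tanh x)\<^sup>2"
proof -
  have "(cosh x)\<^sup>2 \<noteq> 0" by simp
  then show ?thesis
    using cosh_square_eq[of x] by (simp add: sech_def tanh_def field_simps)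
qed

lemma has_field_derivative_tanh_sech_sq: "(tanh has_field_derivative (sech x)\<^sup>2) (at x)"
  by (auto intro!: derivative_eq_intros simp: sech_sq_eq)

lemma continuous_on_sech [continuous_intros]: "continuous_on A sech"
  unfolding sech_def by (intro continuous_intros) auto

text \<open>Puts limits at infinity into the extended-real form required by the fundamental theorem
  of calculus for improper interval integrals.\<close>

lemma tendsto_real_of_ereal_at_infty:
  assumes "(F \<longlongrightarrow> A) at_bot" "(F \<longlongrightarrow> B) at_top"
  shows "((F \<circ> real_of_ereal) \<longlongrightarrow> A) (at_right (- \<infinity>))"
    and "((F \<circ> real_of_ereal) \<longlongrightarrow> B) (at_left \<infinity>)"
  using assms by (simp_all add: ereal_tendsto_simps1)

text \<open>The antiderivative \<open>tanh\<close> runs from \<open>-1\<close> to \<open>1\<close>,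
  and for a nonnegative integrand this yields integrability as well as the value. The function later
  dominates every integral over the line.\<close>

lemma
  shows integrable_sech_sq: "integrable lborel (\<lambda>x. (sech x)\<^sup>2)"
    and integral_sech_sq: "(LINT x|lborel. (sech x)\<^sup>2) = 2"
proof -
  note lim = tendsto_real_of_ereal_at_infty[OF tanh_real_at_bot tanh_real_at_top]
  have cont: "isCont (\<lambda>x. (sech x)\<^sup>2) x" for x
    by (rule continuous_on_interior[of UNIV]) (auto intro!: continuous_intros)
  have "set_integrable lborel (einterval (-\<infinity>) \<infinity>) (\<lambda>x. (sech x)\<^sup>2)"
    by (rule interval_integral_FTC_nonneg(1)[OF _ _ _ _ lim])
      (use cont has_field_derivative_tanh_sech_sq in auto)
  then show "integrable lborel (\<lambda>x. (sech x)\<^sup>2)"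
    by (simp add: set_integrable_def)
  have "(LBINT x=-\<infinity>..\<infinity>. (sech x)\<^sup>2) = 1 - (- 1)"
    by (rule interval_integral_FTC_nonneg(2)[OF _ _ _ _ lim])
      (use cont has_field_derivative_tanh_sech_sq in auto)
  then show "(LINT x|lborel. (sech x)\<^sup>2) = 2"
    by (simp add: interval_lebesgue_integral_def set_lebesgue_integral_def)
qed

section \<open>Moments of powers of \<open>tanh\<close> against a modulated \<open>sech\<close>
  squared\<close>

text \<open>For fixed \<open>k\<close> the linear span of this family is closed under
  differentiation, which is the source of the moment recurrence.\<close>

definition sech_sq_wave :: "real \<Rightarrow> nat \<Rightarrow> real \<Rightarrow> complex" where
  "sech_sq_wave k n y = of_real (tanh y ^ n * (sech y)\<^sup>2) * exp (\<i> * of_real (y * k))"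

lemma continuous_on_sech_sq_wave: "continuous_on A (sech_sq_wave k n)"
  unfolding sech_sq_wave_def by (intro continuous_intros) auto

text \<open>The exponential has modulus \<open>1\<close> and \<open>tanh\<close> stays between
  \<open>-1\<close> and \<open>1\<close>. The bound is uniform in \<open>k\<close> and
  \<open>n\<close>.\<close>

lemma norm_sech_sq_wave_le: "norm (sech_sq_wave k n y) \<le> (sech y)\<^sup>2"
proof -
  have "\<bar>tanh y\<bar> ^ n \<le> 1"
    using tanh_real_lt_1[of y] tanh_real_gt_neg1[of y] by (intro power_le_one) auto
  then show ?thesis
    by (simp add: sech_sq_wave_def norm_mult norm_power mult_left_le_one_le)
qed

lemma integrable_sech_sq_wave: "integrable lborel (sech_sq_wave k n)"
  using integrable_sech_sq
proof (rule Bochner_Integration.integrable_bound)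
  show "sech_sq_wave k n \<in> borel_measurable lborel"
    using borel_measurable_continuous_onI[OF continuous_on_sech_sq_wave] by simp
qed (use norm_sech_sq_wave_le in auto)

lemma tendsto_sech_sq_wave_0:
  "(sech_sq_wave k n \<longlongrightarrow> 0) at_bot" "(sech_sq_wave k n \<longlongrightarrow> 0) at_top"
proof -
  have "((\<lambda>y. 1 - (tanh y)\<^sup>2) \<longlongrightarrow> 1 - (-1)\<^sup>2) (at_bot :: real filter)"
    by (intro tendsto_intros tanh_real_at_bot)
  then have "((\<lambda>y. (sech y)\<^sup>2) \<longlongrightarrow> 0) at_bot"
    by (simp add: sech_sq_eq)
  then show "(sech_sq_wave k n \<longlongrightarrow> 0) at_bot"
    by (rule Lim_null_comparison[rotated]) (auto intro!: always_eventually norm_sech_sq_wave_le)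
  have "((\<lambda>y. 1 - (tanh y)\<^sup>2) \<longlongrightarrow> 1 - 1\<^sup>2) (at_top :: real filter)"
    by (intro tendsto_intros tanh_real_at_top)
  then have "((\<lambda>y. (sech y)\<^sup>2) \<longlongrightarrow> 0) at_top"
    by (simp add: sech_sq_eq)
  then show "(sech_sq_wave k n \<longlongrightarrow> 0) at_top"
    by (rule Lim_null_comparison[rotated]) (auto intro!: always_eventually norm_sech_sq_wave_le)
qed

definition sech_sq_moment :: "real \<Rightarrow> nat \<Rightarrow> complex" where
  "sech_sq_moment k n = (LINT y|lborel. sech_sq_wave k n y)"

text \<open>Writing one factor \<open>(sech y) ^ 2\<close> as \<open>1 - (tanh y) ^ 2\<close> after
  the product rule keeps every term inside the family. For \<open>n = 0\<close> the truncated index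
  \<open>n - 1\<close> is harmless, since its coefficient is zero.\<close>

lemma has_vector_derivative_sech_sq_wave:
  "(sech_sq_wave k n has_vector_derivative
     of_nat n * sech_sq_wave k (n - 1) y - of_nat (n + 2) * sech_sq_wave k (Suc n) y
     + \<i> * of_real k * sech_sq_wave k n y) (at y)"
proof -
  have 1: "((\<lambda>y. tanh y ^ n * (sech y)\<^sup>2) has_real_derivative
      real n * (tanh y ^ (n - 1) * (sech y)\<^sup>2) - real (n + 2) * (tanh y ^ Suc n * (sech y)\<^sup>2)) (at y)"
  proof -
    have "((\<lambda>y. tanh y ^ n * (1 - (tanh y)\<^sup>2)) has_real_derivative
        real n * tanh y ^ (n - 1) * (sech y)\<^sup>2 * (1 - (tanh y)\<^sup>2)
         - tanh y ^ n * (2 * tanh y * (sech y)\<^sup>2)) (at y)"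
      by (auto intro!: derivative_eq_intros DERIV_chain2[OF has_field_derivative_tanh_sech_sq]
          simp: sech_sq_eq)
    also have "real n * tanh y ^ (n - 1) * (sech y)\<^sup>2 * (1 - (tanh y)\<^sup>2)
         - tanh y ^ n * (2 * tanh y * (sech y)\<^sup>2) =
        real n * (tanh y ^ (n - 1) * (sech y)\<^sup>2) - real (n + 2) * (tanh y ^ Suc n * (sech y)\<^sup>2)"
      by (cases n) (auto simp: algebra_simps power2_eq_square)
    finally show ?thesis by (simp only: sech_sq_eq)
  qed
  have 2: "((\<lambda>y. exp (\<i> * of_real (y * k))) has_vector_derivative
      \<i> * of_real k * exp (\<i> * of_real (y * k))) (at y)"
    by (auto intro!: derivative_eq_intros has_vector_derivative_real_field simp: mult_ac)
  have "((\<lambda>y. of_real (tanh y ^ n * (sech y)\<^sup>2) * exp (\<i> * of_real (y * k))) has_vector_derivative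
      of_real (tanh y ^ n * (sech y)\<^sup>2) * (\<i> * of_real k * exp (\<i> * of_real (y * k))) +
      of_real (real n * (tanh y ^ (n - 1) * (sech y)\<^sup>2) - real (n + 2) * (tanh y ^ Suc n * (sech y)\<^sup>2))
        * exp (\<i> * of_real (y * k))) (at y)"
    by (rule has_vector_derivative_mult[OF has_vector_derivative_of_real 2])
      (use 1 in \<open>simp add: has_real_derivative_iff_has_vector_derivative\<close>)
  then show ?thesis
    unfolding sech_sq_wave_def by (simp add: algebra_simps)
qed

text \<open>The wave vanishes at both ends of the line, so its derivative integrates to
  zero.\<close>

lemma sech_sq_moment_recurrence:
  "of_nat (n + 2) * sech_sq_moment k (Suc n) =
    of_nat n * sech_sq_moment k (n - 1) + \<i> * of_real k * sech_sq_moment k n"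
proof -
  define f where "f = (\<lambda>y. of_nat n * sech_sq_wave k (n - 1) y
      - of_nat (n + 2) * sech_sq_wave k (Suc n) y + \<i> * of_real k * sech_sq_wave k n y)"
  have int: "integrable lborel f"
    unfolding f_def
    by (intro Bochner_Integration.integrable_add Bochner_Integration.integrable_diff
        integrable_mult_right integrable_sech_sq_wave)
  have "(LBINT y=-\<infinity>..\<infinity>. f y) = 0 - 0"
  proof (rule interval_integral_FTC_integrable)
    show "isCont f y" for y
      unfolding f_def
      by (rule continuous_on_interior[of UNIV])
        (auto intro!: continuous_intros continuous_on_sech_sq_wave)
    show "(sech_sq_wave k n has_vector_derivative f y) (at y)" for y
      unfolding f_def by (rule has_vector_derivative_sech_sq_wave)
  qed (use int tendsto_real_of_ereal_at_infty[OF tendsto_sech_sq_wave_0]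
      in \<open>auto simp: set_integrable_def\<close>)
  then have "(LINT y|lborel. f y) = 0"
    by (simp add: interval_lebesgue_integral_def set_lebesgue_integral_def)
  moreover have "(LINT y|lborel. f y) = of_nat n * sech_sq_moment k (n - 1)
      - of_nat (n + 2) * sech_sq_moment k (Suc n) + \<i> * of_real k * sech_sq_moment k n"
    unfolding f_def sech_sq_moment_def
    by (simp only: Bochner_Integration.integral_add Bochner_Integration.integral_diff
        integral_mult_right_zero Bochner_Integration.integrable_add Bochner_Integration.integrable_diff
        integrable_mult_right integrable_sech_sq_wave)
  ultimately show ?thesis by (simp add: algebra_simps)
qed

text \<open>The cases \<open>n = 0\<close>, \<open>1\<close>, \<open>2\<close> of the recurrence,
  solved in turn; the integrands are cubic in \<open>tanh\<close>, so the third moment is the last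
  one required.\<close>

lemma sech_sq_moments:
  defines "M \<equiv> sech_sq_moment"
  shows "M k 1 = \<i> * of_real k / 2 * M k 0"
    and "M k 2 = (2 - (of_real k)\<^sup>2) / 6 * M k 0"
    and "M k 3 = \<i> * of_real k * (8 - (of_real k)\<^sup>2) / 24 * M k 0"
proof -
  show 1: "M k 1 = \<i> * of_real k / 2 * M k 0"
    using sech_sq_moment_recurrence[of 0 k] by (simp add: M_def field_simps)
  have "3 * M k 2 = M k 0 + \<i> * of_real k * M k 1"
    using sech_sq_moment_recurrence[of 1 k] by (simp add: M_def numeral_2_eq_2)
  then have "M k 2 = (M k 0 + \<i> * of_real k * (\<i> * of_real k / 2 * M k 0)) / 3"
    unfolding 1 by (simp add: field_simps)
  then show 2: "M k 2 = (2 - (of_real k)\<^sup>2) / 6 * M k 0"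
    by (simp add: field_simps power2_eq_square)
  have "4 * M k 3 = 2 * M k 1 + \<i> * of_real k * M k 2"
    using sech_sq_moment_recurrence[of 2 k] by (simp add: M_def numeral_3_eq_3)
  then have "M k 3 = (2 * (\<i> * of_real k / 2 * M k 0) + \<i> * of_real k * ((2 - (of_real k)\<^sup>2) / 6 * M k 0)) / 4"
    unfolding 1 2 by (simp add: field_simps)
  then show "M k 3 = \<i> * of_real k * (8 - (of_real k)\<^sup>2) / 24 * M k 0"
    by (simp add: field_simps power2_eq_square)
qed

section \<open>The Fourier transform of \<open>sech\<close> squared\<close>

text \<open>At \<open>k = 0\<close> the contour argument degenerates to \<open>0 = 0\<close>, so that case is computed directly.\<close>

lemma sech_sq_moment_0: "sech_sq_moment k 0 = of_real (pi * id_cosech k)"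
proof (cases "k = 0")
  case True
  then have "sech_sq_moment k 0 = of_real (LINT x|lborel. (sech x)\<^sup>2)"
    by (simp add: sech_sq_moment_def sech_sq_wave_def del: of_real_power)
  then show ?thesis
    using True by (simp add: integral_sech_sq id_cosech_def)
next
  case False
  define f where "f = (\<lambda>z. exp (\<i> * of_real k * z) / (cosh z)\<^sup>2)"
  define A where "A = complex_of_real (1 - exp (- (pi * k)))"
  define B where "B = complex_of_real (2 * pi * k * exp (- (pi * k / 2)))"
  have "cosh (complex_of_real x) = of_real (cosh x)" for x
    by (simp add: cosh_field_def exp_of_real flip: of_real_minus)
  then have f_eq: "f (of_real x) = sech_sq_wave k 0 x" for x
    by (simp add: f_def sech_sq_wave_def sech_def power_divide mult_ac)
  \<comment> \<open>Dominated convergence passes from the truncated integrals, which the contour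
    controls, to the whole line.\<close>
  have "((\<lambda>R. LINT x:{- R..R}|lborel. sech_sq_wave k 0 x) \<longlongrightarrow> sech_sq_moment k 0) at_top"
    unfolding set_lebesgue_integral_def sech_sq_moment_def
  proof (rule integral_dominated_convergence_at_top)
    show "integrable lborel (\<lambda>x. (sech x)\<^sup>2)" by (rule integrable_sech_sq)
    show "AE x in lborel. ((\<lambda>R. indicator {- R..R} x *\<^sub>R sech_sq_wave k 0 x) \<longlongrightarrow> sech_sq_wave k 0 x) at_top"
    proof (rule AE_I2)
      fix x :: real
      have "eventually (\<lambda>R. indicator {- R..R} x *\<^sub>R sech_sq_wave k 0 x = sech_sq_wave k 0 x) at_top"
        using eventually_ge_at_top[of "\<bar>x\<bar>"] by eventually_elim (auto simp: indicator_def)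
      then show "((\<lambda>R. indicator {- R..R} x *\<^sub>R sech_sq_wave k 0 x) \<longlongrightarrow> sech_sq_wave k 0 x) at_top"
        by (rule tendsto_eventually)
    qed
    show "\<forall>\<^sub>F R in at_top. AE x in lborel. norm (indicator {- R..R} x *\<^sub>R sech_sq_wave k 0 x) \<le> (sech x)\<^sup>2"
      using norm_sech_sq_wave_le by (intro always_eventually allI AE_I2) (auto simp: indicator_def)
    show [measurable]: "sech_sq_wave k 0 \<in> borel_measurable lborel"
      using integrable_sech_sq_wave by (rule borel_measurable_integrable)
    show "(\<lambda>x. indicator {- R..R} x *\<^sub>R sech_sq_wave k 0 x) \<in> borel_measurable lborel" for R :: real
      by measurable
  qed
  moreover have "(LINT x:{- R..R}|lborel. sech_sq_wave k 0 x) = integral {- R..R} (\<lambda>x. f (of_real x))" for R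
    unfolding f_eq using integrable_sech_sq_wave
    by (intro set_borel_integral_eq_integral)
      (auto simp: set_integrable_def intro: integrable_mult_indicator)
  ultimately have "((\<lambda>R. integral {- R..R} (\<lambda>x. f (of_real x))) \<longlongrightarrow> sech_sq_moment k 0) at_top"
    by simp
  then have "((\<lambda>R. A * integral {- R..R} (\<lambda>x. f (of_real x)) - B) \<longlongrightarrow> A * sech_sq_moment k 0 - B) at_top"
    by (intro tendsto_intros)
  \<comment> \<open>The vertical sides vanish in the limit because \<open>sinh R\<close> grows
    without bound; uniqueness of limits then gives a linear equation for the moment.\<close>
  moreover have "((\<lambda>R. A * integral {- R..R} (\<lambda>x. f (of_real x)) - B) \<longlongrightarrow> 0) at_top"
  proof (rule Lim_null_comparison)
    show "\<forall>\<^sub>F R in at_top. norm (A * integral {- R..R} (\<lambda>x. f (of_real x)) - B)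
        \<le> 2 * (exp (pi * \<bar>k\<bar>) / (sinh R)\<^sup>2 * pi)"
      using eventually_gt_at_top[of 0]
      by eventually_elim (unfold A_def B_def f_def, rule sech_sq_truncated_fourier)
    have "filterlim (\<lambda>R::real. (sinh R)\<^sup>2) at_top at_top"
      by (intro filterlim_pow_at_top sinh_real_at_top) auto
    then have "((\<lambda>R::real. exp (pi * \<bar>k\<bar>) / (sinh R)\<^sup>2) \<longlongrightarrow> 0) at_top"
      by (intro tendsto_divide_0[OF tendsto_const] filterlim_at_top_imp_at_infinity)
    then show "((\<lambda>R::real. 2 * (exp (pi * \<bar>k\<bar>) / (sinh R)\<^sup>2 * pi)) \<longlongrightarrow> 0) at_top"
      by (intro tendsto_mult_right_zero tendsto_mult_left_zero)
  qed
  ultimately have "A * sech_sq_moment k 0 - B = 0"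
    by (rule tendsto_unique[rotated]) simp
  moreover have "A \<noteq> 0"
    using False by (simp add: A_def)
  ultimately have "sech_sq_moment k 0 = B / A"
    by (simp add: field_simps)
  also have "B / A = of_real (2 * pi * k * exp (- (pi * k / 2)) / (1 - exp (- (pi * k))))"
    by (simp add: A_def B_def)
  \<comment> \<open>Multiplying numerator and denominator by \<open>exp (pi * k / 2)\<close> turns
    the denominator into \<open>2 * sinh (pi * k / 2)\<close>.\<close>
  also have "2 * pi * k * exp (- (pi * k / 2)) / (1 - exp (- (pi * k))) = pi * id_cosech k"
  proof -
    have e: "exp (- (pi * k)) = exp (- (pi * k / 2)) * exp (- (pi * k / 2))"
      by (simp flip: exp_add)
    have "exp (- (pi * k)) \<noteq> 1" using False by simp
    then have "1 - exp (- (pi * k / 2)) * exp (- (pi * k / 2)) \<noteq> 0"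
      unfolding e by simp
    then have "2 * pi * k * exp (- (pi * k / 2)) / (1 - exp (- (pi * k / 2)) * exp (- (pi * k / 2))) =
        pi * (k * (1 / ((exp (pi * k / 2) - exp (- (pi * k / 2))) / 2)))"
      by (simp add: exp_minus field_simps)
    then show ?thesis
      using False unfolding e id_cosech_def cosech_def sinh_field_def by simp
  qed
  finally show ?thesis .
qed

section \<open>Rescaling and expansion of the integrands\<close>

text \<open>With frequency \<open>s * a\<close> a factor \<open>s ^ 2\<close> leaves the numerator.
  The denominator is deliberately left unscaled, since it reappears verbatim in the final
  formula.\<close>

lemma \<Psi>1_scaled:
  assumes "s > 0"
  shows "\<Psi>1 (s\<^sup>2) x (s * a) = of_real (s\<^sup>2 / sqrt (2 * pi)) / (of_real \<bar>s * a\<bar> - \<i> * of_real s)\<^sup>2 *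
    (of_real a + \<i> * of_real (tanh (s * x)))\<^sup>2 * exp (\<i> * of_real (s * x * a))"
proof -
  have "(of_real (s * a) + \<i> * of_real (s * tanh (s * x)))\<^sup>2 =
      of_real (s\<^sup>2) * (of_real a + \<i> * of_real (tanh (s * x)))\<^sup>2"
    by (simp add: power2_eq_square algebra_simps)
  then show ?thesis
    using assms by (simp add: \<Psi>1_def real_sqrt_abs mult_ac)
qed

lemma \<Psi>2_scaled:
  assumes "s > 0"
  shows "\<Psi>2 (s\<^sup>2) x (s * a) = of_real (s\<^sup>2 / sqrt (2 * pi)) / (of_real \<bar>s * a\<bar> - \<i> * of_real s)\<^sup>2 *
    of_real ((sech (s * x))\<^sup>2) * exp (\<i> * of_real (s * x * a))"
  using assms by (simp add: \<Psi>2_def power_mult_distrib mult_ac)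

lemma \<phi>_scaled: "s > 0 \<Longrightarrow> (\<phi> (s\<^sup>2) x)\<^sup>2 = 2 * s\<^sup>2 * (sech (s * x))\<^sup>2"
  by (simp add: \<phi>_def power_mult_distrib)

text \<open>The power \<open>s ^ 6 / pi\<close> gathers \<open>s ^ 2 / sqrt (2 * pi)\<close> from
  each of the two wave functions and \<open>2 * s ^ 2\<close> from the squared soliton
  \<open>\<phi>\<close>.\<close>

definition \<nu>_const :: "real \<Rightarrow> real \<Rightarrow> real \<Rightarrow> complex" where
  "\<nu>_const s a b = of_real (s ^ 6 / pi) /
    ((of_real \<bar>s * a\<bar> - \<i> * of_real s)\<^sup>2 * (of_real \<bar>s * b\<bar> - \<i> * of_real s)\<^sup>2)"

lemma \<nu>_const_split:
  "of_real (s\<^sup>2 / sqrt (2 * pi)) / (of_real \<bar>s * a\<bar> - \<i> * of_real s)\<^sup>2 *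
   (of_real (s\<^sup>2 / sqrt (2 * pi)) / (of_real \<bar>s * b\<bar> - \<i> * of_real s)\<^sup>2) *
   of_real (2 * s\<^sup>2) = \<nu>_const s a b"
proof -
  have "s\<^sup>2 / sqrt (2 * pi) * (s\<^sup>2 / sqrt (2 * pi)) * (2 * s\<^sup>2) = s ^ 6 / pi"
    by (simp add: field_simps power2_eq_square eval_nat_numeral)
  then have *: "of_real (s\<^sup>2 / sqrt (2 * pi)) * of_real (s\<^sup>2 / sqrt (2 * pi)) * of_real (2 * s\<^sup>2) =
      complex_of_real (s ^ 6 / pi)"
    by (simp only: flip: of_real_mult)
  have "u / p * (u / q) * v = u * u * v / (p * q)" for u v p q :: complex
    by simp
  then show ?thesis
    by (simp only: * \<nu>_const_def)
qed

text \<open>The substitution \<open>y = s * x\<close> produces the factor \<open>1 / s\<close>;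
  linearity does the rest.\<close>

lemma integral_sech_sq_wave_sum:
  fixes F :: "real \<Rightarrow> complex"
  assumes "s > 0"
    and "\<And>x. F x = C * (\<Sum>n<N. c n * sech_sq_wave k n (s * x))"
  shows "integrable lborel F"
    and "(LINT x|lborel. F x) = C / of_real s * (\<Sum>n<N. c n * sech_sq_moment k n)"
proof -
  define G where "G = (\<lambda>y. C * (\<Sum>n<N. c n * sech_sq_wave k n y))"
  \<comment> \<open>The summand \<open>0\<close> matches the affine substitution rule, with zero
    translation.\<close>
  have F: "F = (\<lambda>x. G (0 + s * x))"
    using assms(2) by (simp add: G_def fun_eq_iff)
  have G: "integrable lborel G"
    unfolding G_def by (intro integrable_mult_right Bochner_Integration.integrable_sum integrable_sech_sq_wave)
  show "integrable lborel F"
    unfolding F using G assms(1) by (intro lborel_integrable_real_affine) auto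
  have "(LINT y|lborel. G y) = C * (\<Sum>n<N. c n * sech_sq_moment k n)"
    unfolding G_def sech_sq_moment_def
    by (simp add: Bochner_Integration.integral_sum integrable_sech_sq_wave)
  moreover have "(LINT y|lborel. G y) = \<bar>s\<bar> *\<^sub>R (LINT x|lborel. F x)"
    unfolding F using assms(1) by (intro lborel_integral_real_affine) auto
  ultimately show "(LINT x|lborel. F x) = C / of_real s * (\<Sum>n<N. c n * sech_sq_moment k n)"
    using assms(1) by (simp add: scaleR_conv_of_real field_simps)
qed

lemma of_real_sech_sq: "(of_real ((sech y)\<^sup>2) :: complex) = 1 - (of_real (tanh y))\<^sup>2"
  by (simp add: sech_sq_eq)

lemma exp_wave_mult:
  "exp (\<i> * of_real (y * a)) * exp (\<i> * of_real (y * b)) = exp (\<i> * of_real (y * (a + b)))"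
  by (simp add: algebra_simps flip: exp_add)

text \<open>With \<open>T = tanh (s * x)\<close>, the list contains the coefficients of
  \<open>(a * b - T ^ 2 + \<i> * (a + b) * T) ^ 2 - (1 - T ^ 2) ^ 2\<close> in increasing powers of
  \<open>T\<close>.\<close>

lemma \<nu>_pp_integrand_scaled:
  assumes "s > 0"
  shows "\<nu>_pp_integrand (s\<^sup>2) (s * a) (s * b) x = \<nu>_const s a b *
    (\<Sum>n<4. [of_real ((a * b)\<^sup>2 - 1), 2 * \<i> * of_real ((a + b) * (a * b)),
        of_real (2 - (a + b)\<^sup>2 - 2 * (a * b)), - 2 * \<i> * of_real (a + b)] ! n *
      sech_sq_wave (a + b) n (s * x))"
proof -
  define y T S where "y = s * x" and "T = complex_of_real (tanh y)"
    and "S = complex_of_real ((sech y)\<^sup>2)"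
  define E where "E = exp (\<i> * of_real (y * (a + b)))"
  have wave: "sech_sq_wave (a + b) n y = T ^ n * S * E" for n
    by (simp add: sech_sq_wave_def T_def S_def E_def)
  \<comment> \<open>Stated for abstract factors, so that prefactors, polynomial part and
    exponentials are regrouped by one rewrite.\<close>
  have alg: "(p * u * e * (q * v * e') - p * S * e * (q * S * e')) * (w * S) =
      p * q * w * ((u * v - S\<^sup>2) * S * (e * e'))" for p q u v w e e' :: complex
    by (simp add: algebra_simps power2_eq_square)
  have "\<nu>_pp_integrand (s\<^sup>2) (s * a) (s * b) x = \<nu>_const s a b *
      (((of_real a + \<i> * T)\<^sup>2 * (of_real b + \<i> * T)\<^sup>2 - S\<^sup>2) * S * E)"
    unfolding \<nu>_pp_integrand_def \<Psi>1_scaled[OF assms] \<Psi>2_scaled[OF assms] \<phi>_scaled[OF assms]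
      of_real_mult[of "2 * s\<^sup>2"] y_def[symmetric] T_def[symmetric] S_def[symmetric]
      alg \<nu>_const_split exp_wave_mult E_def ..
  also have "((of_real a + \<i> * T)\<^sup>2 * (of_real b + \<i> * T)\<^sup>2 - S\<^sup>2) =
      of_real ((a * b)\<^sup>2 - 1) + 2 * \<i> * of_real ((a + b) * (a * b)) * T
      + of_real (2 - (a + b)\<^sup>2 - 2 * (a * b)) * T\<^sup>2 + - 2 * \<i> * of_real (a + b) * T ^ 3"
    unfolding S_def of_real_sech_sq T_def[symmetric]
    by (simp add: power2_eq_square power3_eq_cube algebra_simps)
  finally show ?thesis
    unfolding y_def[symmetric] wave
    by (simp add: eval_nat_numeral algebra_simps)
qed

text \<open>In the difference of squares the \<open>T ^ 2\<close> terms cancel, leaving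
  \<open>a ^ 2 - b ^ 2 + 2 * \<i> * (a - b) * T\<close>. Multiplying by \<open>S = 1 - T ^ 2\<close>
  gives the listed cubic; the other factor \<open>S\<close> belongs to the wave.\<close>

lemma \<nu>_pm_integrand_scaled:
  assumes "s > 0"
  shows "\<nu>_pm_integrand (s\<^sup>2) (s * a) (s * b) x = \<nu>_const s a b *
    (\<Sum>n<4. [of_real (a\<^sup>2 - b\<^sup>2), 2 * \<i> * of_real (a - b),
        of_real (b\<^sup>2 - a\<^sup>2), - 2 * \<i> * of_real (a - b)] ! n *
      sech_sq_wave (a + b) n (s * x))"
proof -
  define y T S where "y = s * x" and "T = complex_of_real (tanh y)"
    and "S = complex_of_real ((sech y)\<^sup>2)"
  define E where "E = exp (\<i> * of_real (y * (a + b)))"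
  have wave: "sech_sq_wave (a + b) n y = T ^ n * S * E" for n
    by (simp add: sech_sq_wave_def T_def S_def E_def)
  have alg: "(p * u * e * (q * S * e') - p * S * e * (q * v * e')) * (w * S) =
      p * q * w * ((u - v) * S * S * (e * e'))" for p q u v w e e' :: complex
    by (simp add: algebra_simps)
  have "\<nu>_pm_integrand (s\<^sup>2) (s * a) (s * b) x = \<nu>_const s a b *
      (((of_real a + \<i> * T)\<^sup>2 - (of_real b + \<i> * T)\<^sup>2) * S * S * E)"
    unfolding \<nu>_pm_integrand_def \<Psi>1_scaled[OF assms] \<Psi>2_scaled[OF assms] \<phi>_scaled[OF assms]
      of_real_mult[of "2 * s\<^sup>2"] y_def[symmetric] T_def[symmetric] S_def[symmetric]
      alg \<nu>_const_split exp_wave_mult E_def ..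
  also have "((of_real a + \<i> * T)\<^sup>2 - (of_real b + \<i> * T)\<^sup>2) * S =
      of_real (a\<^sup>2 - b\<^sup>2) + 2 * \<i> * of_real (a - b) * T
      + of_real (b\<^sup>2 - a\<^sup>2) * T\<^sup>2 + - 2 * \<i> * of_real (a - b) * T ^ 3"
    unfolding S_def of_real_sech_sq T_def[symmetric]
    by (simp add: power2_eq_square power3_eq_cube algebra_simps)
  finally show ?thesis
    unfolding y_def[symmetric] wave
    by (simp add: eval_nat_numeral algebra_simps)
qed

section \<open>Closed forms in the rescaled variables\<close>

lemma \<nu>_pp_scaled:
  assumes "s > 0"
  shows "\<nu>_pp (s\<^sup>2) (s * a) (s * b) =
    \<nu>_const s a b / of_real s * of_real (pi * id_cosech (a + b)) *
    of_real ((a\<^sup>2 + b\<^sup>2 + 2) * (a\<^sup>2 - 4 * a * b + b\<^sup>2 - 2) / 12)"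
proof -
  have "\<nu>_pp (s\<^sup>2) (s * a) (s * b) = \<nu>_const s a b / of_real s *
      (\<Sum>n<4. [of_real ((a * b)\<^sup>2 - 1), 2 * \<i> * of_real ((a + b) * (a * b)),
        of_real (2 - (a + b)\<^sup>2 - 2 * (a * b)), - 2 * \<i> * of_real (a + b)] ! n *
      sech_sq_moment (a + b) n)"
    unfolding \<nu>_pp_def
    by (rule integral_sech_sq_wave_sum(2)[OF assms \<nu>_pp_integrand_scaled[OF assms]])
  also have "(\<Sum>n<4. [of_real ((a * b)\<^sup>2 - 1), 2 * \<i> * of_real ((a + b) * (a * b)),
        of_real (2 - (a + b)\<^sup>2 - 2 * (a * b)), - 2 * \<i> * of_real (a + b)] ! n *
      sech_sq_moment (a + b) n) = of_real ((a * b)\<^sup>2 - 1) * sech_sq_moment (a + b) 0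
      + 2 * \<i> * of_real ((a + b) * (a * b)) * sech_sq_moment (a + b) 1
      + of_real (2 - (a + b)\<^sup>2 - 2 * (a * b)) * sech_sq_moment (a + b) 2
      + - 2 * \<i> * of_real (a + b) * sech_sq_moment (a + b) 3"
    by (simp add: eval_nat_numeral)
  \<comment> \<open>With \<open>k = a + b\<close> and \<open>P = a * b\<close>, twelve times the
    polynomial factor is \<open>k ^ 4 - 8 * k ^ 2 * P + 12 * P ^ 2 - 8 * P - 4\<close>, which splits
    as \<open>(k ^ 2 - 2 * P + 2) * (k ^ 2 - 6 * P - 2)\<close>.\<close>
  also have "\<dots> = of_real (pi * id_cosech (a + b)) *
      of_real ((a\<^sup>2 + b\<^sup>2 + 2) * (a\<^sup>2 - 4 * a * b + b\<^sup>2 - 2) / 12)"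
    unfolding sech_sq_moments sech_sq_moment_0[symmetric]
    by (simp add: field_simps power2_eq_square)
  finally show ?thesis by (simp only: mult.assoc)
qed

lemma \<nu>_pm_scaled:
  assumes "s > 0"
  shows "\<nu>_pm (s\<^sup>2) (s * a) (s * b) =
    \<nu>_const s a b / of_real s * of_real (pi * id_cosech (a + b)) *
    of_real ((a\<^sup>2 - b\<^sup>2) * (a\<^sup>2 + 2 * a * b + b\<^sup>2 + 4) / 12)"
proof -
  have "\<nu>_pm (s\<^sup>2) (s * a) (s * b) = \<nu>_const s a b / of_real s *
      (\<Sum>n<4. [of_real (a\<^sup>2 - b\<^sup>2), 2 * \<i> * of_real (a - b),
        of_real (b\<^sup>2 - a\<^sup>2), - 2 * \<i> * of_real (a - b)] ! n *
      sech_sq_moment (a + b) n)"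
    unfolding \<nu>_pm_def
    by (rule integral_sech_sq_wave_sum(2)[OF assms \<nu>_pm_integrand_scaled[OF assms]])
  also have "(\<Sum>n<4. [of_real (a\<^sup>2 - b\<^sup>2), 2 * \<i> * of_real (a - b),
        of_real (b\<^sup>2 - a\<^sup>2), - 2 * \<i> * of_real (a - b)] ! n *
      sech_sq_moment (a + b) n) = of_real (a\<^sup>2 - b\<^sup>2) * sech_sq_moment (a + b) 0
      + 2 * \<i> * of_real (a - b) * sech_sq_moment (a + b) 1
      + of_real (b\<^sup>2 - a\<^sup>2) * sech_sq_moment (a + b) 2
      + - 2 * \<i> * of_real (a - b) * sech_sq_moment (a + b) 3"
    by (simp add: eval_nat_numeral)
  \<comment> \<open>Since \<open>(a - b) * (a + b) = a ^ 2 - b ^ 2\<close>, this factor comes out of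
    every term and leaves \<open>((a + b) ^ 2 + 4) / 12\<close>.\<close>
  also have "\<dots> = of_real (pi * id_cosech (a + b)) *
      of_real ((a\<^sup>2 - b\<^sup>2) * (a\<^sup>2 + 2 * a * b + b\<^sup>2 + 4) / 12)"
    unfolding sech_sq_moments sech_sq_moment_0[symmetric]
    by (simp add: field_simps power2_eq_square)
  finally show ?thesis by (simp only: mult.assoc)
qed

text \<open>Of the five powers of \<open>s\<close> left after division, two restore
  \<open>u\<close>, two restore \<open>v\<close>, and one remains as the factor
  \<open>s / 12\<close>; \<open>pi\<close> cancels.\<close>

lemma \<nu>_const_collect:
  assumes "s > 0" "u = s\<^sup>2 * u'" "v = s\<^sup>2 * v'"
  shows "\<nu>_const s a b / of_real s * of_real (pi * h) * of_real (u' * v' / 12) =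
    of_real u * of_real (s / 12) *
    (of_real v / ((of_real \<bar>s * a\<bar> - \<i> * of_real s)\<^sup>2 * (of_real \<bar>s * b\<bar> - \<i> * of_real s)\<^sup>2)) *
    of_real h"
proof -
  have "s ^ 6 / pi / s * (pi * h) * (u' * v' / 12) = u * (s / 12) * v * h"
    using assms by (simp add: field_simps eval_nat_numeral)
  then have *: "complex_of_real (s ^ 6 / pi) / of_real s * of_real (pi * h) * of_real (u' * v' / 12) =
      of_real u * of_real (s / 12) * of_real v * of_real h"
    by (simp only: flip: of_real_mult of_real_divide)
  have "c / d / e * f * g = c / e * f * g / d" "c * e * (f / d) * g = c * e * f * g / d"
    for c d e f g :: complex
    by simp_all
  then show ?thesis
    unfolding \<nu>_const_def by (simp only: *)
qed

section \<open>Return to the original variables\<close>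

lemma integrable_\<nu>_pp_integrand:
  assumes "\<omega> > 0"
  shows "integrable lborel (\<nu>_pp_integrand \<omega> \<xi>1 \<xi>2)"
proof -
  define s a b where "s = sqrt \<omega>" and "a = \<xi>1 / s" and "b = \<xi>2 / s"
  have s: "s > 0" and \<omega>: "\<omega> = s\<^sup>2" and \<xi>: "\<xi>1 = s * a" "\<xi>2 = s * b"
    using assms by (simp_all add: s_def a_def b_def)
  show ?thesis
    unfolding \<omega> \<xi>
    by (rule integral_sech_sq_wave_sum(1)[OF s \<nu>_pp_integrand_scaled[OF s]])
qed

lemma integrable_\<nu>_pm_integrand:
  assumes "\<omega> > 0"
  shows "integrable lborel (\<nu>_pm_integrand \<omega> \<xi>1 \<xi>2)"
proof -
  define s a b where "s = sqrt \<omega>" and "a = \<xi>1 / s" and "b = \<xi>2 / s"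
  have s: "s > 0" and \<omega>: "\<omega> = s\<^sup>2" and \<xi>: "\<xi>1 = s * a" "\<xi>2 = s * b"
    using assms by (simp_all add: s_def a_def b_def)
  show ?thesis
    unfolding \<omega> \<xi>
    by (rule integral_sech_sq_wave_sum(1)[OF s \<nu>_pm_integrand_scaled[OF s]])
qed

lemma \<nu>_mm_integrand_eq:
  "\<nu>_mm_integrand \<omega> \<xi>1 \<xi>2 = (\<lambda>x. - \<nu>_pp_integrand \<omega> \<xi>1 \<xi>2 x)"
  by (simp add: \<nu>_mm_integrand_def \<nu>_pp_integrand_def fun_eq_iff algebra_simps)

lemma integrable_\<nu>_mm_integrand:
  assumes "\<omega> > 0"
  shows "integrable lborel (\<nu>_mm_integrand \<omega> \<xi>1 \<xi>2)"
  unfolding \<nu>_mm_integrand_eq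
  using integrable_\<nu>_pp_integrand[OF assms] by (rule Bochner_Integration.integrable_minus)

lemma \<nu>_mm_eq: "\<nu>_mm \<omega> \<xi>1 \<xi>2 = - \<nu>_pp \<omega> \<xi>1 \<xi>2"
  by (simp add: \<nu>_mm_def \<nu>_pp_def \<nu>_mm_integrand_eq)

lemma \<nu>_pp_eq:
  assumes "\<omega> > 0"
  shows "\<nu>_pp \<omega> \<xi>1 \<xi>2 =
      complex_of_real (\<xi>1\<^sup>2 + \<xi>2\<^sup>2 + 2 * \<omega>) * complex_of_real (sqrt \<omega> / 12) *
      (complex_of_real (\<xi>1\<^sup>2 - 4 * \<xi>1 * \<xi>2 + \<xi>2\<^sup>2 - 2 * \<omega>) /
       ((complex_of_real \<bar>\<xi>1\<bar> - \<i> * complex_of_real (sqrt \<omega>))\<^sup>2 *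
        (complex_of_real \<bar>\<xi>2\<bar> - \<i> * complex_of_real (sqrt \<omega>))\<^sup>2)) *
      complex_of_real (id_cosech ((\<xi>1 + \<xi>2) / sqrt \<omega>))"
proof -
  define s a b where "s = sqrt \<omega>" and "a = \<xi>1 / s" and "b = \<xi>2 / s"
  have s: "s > 0" and \<omega>: "\<omega> = s\<^sup>2" and \<xi>: "\<xi>1 = s * a" "\<xi>2 = s * b"
    using assms by (simp_all add: s_def a_def b_def)
  have k: "(\<xi>1 + \<xi>2) / s = a + b"
    by (simp add: a_def b_def add_divide_distrib)
  show ?thesis
    \<comment> \<open>Order matters: \<open>sqrt \<omega>\<close> and the quotient by
      \<open>s\<close> are folded before \<open>\<omega>\<close> and the frequencies are expanded,
      which would destroy these patterns.\<close>
    unfolding s_def[symmetric] k unfolding \<omega> \<xi> \<nu>_pp_scaled[OF s]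
    by (rule \<nu>_const_collect[OF s]) (simp_all add: power2_eq_square algebra_simps)
qed

lemma \<nu>_pm_eq:
  assumes "\<omega> > 0"
  shows "\<nu>_pm \<omega> \<xi>1 \<xi>2 =
      complex_of_real (\<xi>1\<^sup>2 - \<xi>2\<^sup>2) * complex_of_real (sqrt \<omega> / 12) *
      (complex_of_real (\<xi>1\<^sup>2 + 2 * \<xi>1 * \<xi>2 + \<xi>2\<^sup>2 + 4 * \<omega>) /
       ((complex_of_real \<bar>\<xi>1\<bar> - \<i> * complex_of_real (sqrt \<omega>))\<^sup>2 *
        (complex_of_real \<bar>\<xi>2\<bar> - \<i> * complex_of_real (sqrt \<omega>))\<^sup>2)) *
      complex_of_real (id_cosech ((\<xi>1 + \<xi>2) / sqrt \<omega>))"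
proof -
  define s a b where "s = sqrt \<omega>" and "a = \<xi>1 / s" and "b = \<xi>2 / s"
  have s: "s > 0" and \<omega>: "\<omega> = s\<^sup>2" and \<xi>: "\<xi>1 = s * a" "\<xi>2 = s * b"
    using assms by (simp_all add: s_def a_def b_def)
  have k: "(\<xi>1 + \<xi>2) / s = a + b"
    by (simp add: a_def b_def add_divide_distrib)
  show ?thesis
    unfolding s_def[symmetric] k unfolding \<omega> \<xi> \<nu>_pm_scaled[OF s]
    by (rule \<nu>_const_collect[OF s]) (simp_all add: power2_eq_square algebra_simps)
qed

text \<open>The integrability claims give the formulas their intended content, because the Bochner
  integral takes the default value zero on non-integrable functions.\<close>

theorem lemma6p3:
  fixes \<omega> \<xi>1 \<xi>2 :: real
  assumes "\<omega> > 0"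
  shows "integrable lborel (\<nu>_pp_integrand \<omega> \<xi>1 \<xi>2) \<and>
    integrable lborel (\<nu>_mm_integrand \<omega> \<xi>1 \<xi>2) \<and>
    integrable lborel (\<nu>_pm_integrand \<omega> \<xi>1 \<xi>2) \<and>
    \<nu>_pp \<omega> \<xi>1 \<xi>2 =
      complex_of_real (\<xi>1\<^sup>2 + \<xi>2\<^sup>2 + 2 * \<omega>) * complex_of_real (sqrt \<omega> / 12) *
      (complex_of_real (\<xi>1\<^sup>2 - 4 * \<xi>1 * \<xi>2 + \<xi>2\<^sup>2 - 2 * \<omega>) /
       ((complex_of_real \<bar>\<xi>1\<bar> - \<i> * complex_of_real (sqrt \<omega>))\<^sup>2 *
        (complex_of_real \<bar>\<xi>2\<bar> - \<i> * complex_of_real (sqrt \<omega>))\<^sup>2)) *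
      complex_of_real (id_cosech ((\<xi>1 + \<xi>2) / sqrt \<omega>)) \<and>
    \<nu>_pm \<omega> \<xi>1 \<xi>2 =
      complex_of_real (\<xi>1\<^sup>2 - \<xi>2\<^sup>2) * complex_of_real (sqrt \<omega> / 12) *
      (complex_of_real (\<xi>1\<^sup>2 + 2 * \<xi>1 * \<xi>2 + \<xi>2\<^sup>2 + 4 * \<omega>) /
       ((complex_of_real \<bar>\<xi>1\<bar> - \<i> * complex_of_real (sqrt \<omega>))\<^sup>2 *
        (complex_of_real \<bar>\<xi>2\<bar> - \<i> * complex_of_real (sqrt \<omega>))\<^sup>2)) *
      complex_of_real (id_cosech ((\<xi>1 + \<xi>2) / sqrt \<omega>)) \<and>
    \<nu>_mm \<omega> \<xi>1 \<xi>2 = - \<nu>_pp \<omega> \<xi>1 \<xi>2"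
  using assms
  by (intro conjI integrable_\<nu>_pp_integrand integrable_\<nu>_mm_integrand integrable_\<nu>_pm_integrand
      \<nu>_pp_eq \<nu>_pm_eq \<nu>_mm_eq)

end
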